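(* Let $N\ge2$, let $\omega\subset\mathbb R^{N-1}$ be a smooth bounded domain, let $\mathcal C_\omega=\omega\times(0,+\infty)\subset\mathbb R^N$, and let $\partial\mathcal C_\omega^+=\partial\mathcal C_\omega\cap\{x_N>0\}$ be its lateral boundary. Let $\varphi\in C^2(\overline\omega)$ with $\varphi>0$ in $\overline\omega$, and let $\Gamma_\varphi=\{(x',x_N)\in\mathbb R^N:\ x'\in\omega,\ x_N=\varphi(x')\}$. Assume that $\Gamma_\varphi$ is a constant mean curvature surface which meets $\partial\mathcal C_\omega^+$ orthogonally. Then $\Gamma_\varphi$ is a minimal hypersurface (its mean curvature is $0$) and $\varphi$ is a constant function.
   Context: The exterior unit normal to $\Gamma_\varphi$ at $(x',\varphi(x'))$, $x'\in\overline\omega$, is $\nu_{\Gamma_\varphi}=\frac{1}{\sqrt{1+|\nabla\varphi(x')|^2}}(-\nabla\varphi(x'),1)$. The mean curvature of $\Gamma_\varphi$ with respect to it is $$H_{\Gamma_\varphi}=-\frac1{N-1}\operatorname{div}\Big(\frac{\nabla\varphi}{\sqrt{1+|\nabla\varphi|^2}}\Big).$$ "$\Gamma_\varphi$ meets $\partial\mathcal C_\omega^+$ orthogonally" means that $\nu_{\Gamma_\varphi}(x)\cdot\nu_{\partial\mathcal C_\omega^+}(x)=0$ for all $x\in\overline{\Gamma_\varphi}\cap\partial\mathcal C_\omega$, where $\nu_{\partial\mathcal C_\omega^+}(x',x_N)=(\nu_{\partial\omega}(x'),0)$ and $\nu_{\partial\omega}$ is the unit outward normal to $\partial\omega$. 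*)

theory Defs
  imports "HOL-Analysis.Analysis"
begin

section \<open>Differential operators\<close>

definition grad :: "('a::euclidean_space \<Rightarrow> real) \<Rightarrow> 'a \<Rightarrow> 'a" where
  "grad f x = (\<Sum>b\<in>Basis. frechet_derivative f (at x) b *\<^sub>R b)"

definition divergence :: "('a::euclidean_space \<Rightarrow> 'a) \<Rightarrow> 'a \<Rightarrow> real" where
  "divergence F x = (\<Sum>b\<in>Basis. frechet_derivative F (at x) b \<bullet> b)"

section \<open>Regularity classes\<close>

text \<open>The class \<open>C\<^sup>k(U)\<close> for open \<open>U\<close>, by recursion on the partial derivatives.\<close>

fun Ck_on :: "nat \<Rightarrow> ('a::euclidean_space \<Rightarrow> real) \<Rightarrow> 'a set \<Rightarrow> bool" where
  "Ck_on 0 f U \<longleftrightarrow> continuous_on U f"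
| "Ck_on (Suc k) f U \<longleftrightarrow> continuous_on U f \<and> (\<forall>x\<in>U. f differentiable (at x)) \<and>
     (\<forall>b\<in>Basis. Ck_on k (\<lambda>x. frechet_derivative f (at x) b) U)"

definition smooth_on :: "('a::euclidean_space \<Rightarrow> real) \<Rightarrow> 'a set \<Rightarrow> bool" where
  "smooth_on f U \<longleftrightarrow> (\<forall>k. Ck_on k f U)"

definition cont_extends :: "('a::euclidean_space \<Rightarrow> real) \<Rightarrow> 'a set \<Rightarrow> bool" where
  "cont_extends f U \<longleftrightarrow> (\<exists>g. continuous_on (closure U) g \<and> (\<forall>x\<in>U. g x = f x))"

text \<open>All partial derivatives of order at most \<open>k\<close> exist in the open set \<open>U\<close> and extend
  continuously to the closure of \<open>U\<close>.\<close>

fun derivs_extend :: "nat \<Rightarrow> ('a::euclidean_space \<Rightarrow> real) \<Rightarrow> 'a set \<Rightarrow> bool" where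
  "derivs_extend 0 f U \<longleftrightarrow> cont_extends f U"
| "derivs_extend (Suc k) f U \<longleftrightarrow> cont_extends f U \<and> (\<forall>x\<in>U. f differentiable (at x)) \<and>
     (\<forall>b\<in>Basis. derivs_extend k (\<lambda>x. frechet_derivative f (at x) b) U)"

text \<open>The class \<open>C\<^sup>k\<close> of the closure of the open set \<open>U\<close>. The first conjunct says that the boundary
  values of \<open>f\<close> are those of the continuous extension.\<close>

definition Ck_closure :: "nat \<Rightarrow> ('a::euclidean_space \<Rightarrow> real) \<Rightarrow> 'a set \<Rightarrow> bool" where
  "Ck_closure k f U \<longleftrightarrow> continuous_on (closure U) f \<and> derivs_extend k f U"

text \<open>The gradient on the closure of \<open>U\<close>. On the boundary, where \<open>f\<close> has no two-sided derivative,
  it is the continuous extension of the gradient from the inside; at points of \<open>U\<close> it is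
  \<open>grad f\<close> whenever that is continuous.\<close>

definition grad_closure :: "'a set \<Rightarrow> ('a::euclidean_space \<Rightarrow> real) \<Rightarrow> 'a \<Rightarrow> 'a" where
  "grad_closure U f x = Lim (at x within U) (grad f)"

section \<open>Smooth domains and their outward normal\<close>

definition local_defining_function ::
    "'a::euclidean_space set \<Rightarrow> 'a \<Rightarrow> 'a set \<Rightarrow> ('a \<Rightarrow> real) \<Rightarrow> bool" where
  "local_defining_function \<Omega> p U \<rho> \<longleftrightarrow>
     open U \<and> p \<in> U \<and> smooth_on \<rho> U \<and> (\<forall>x\<in>U. grad \<rho> x \<noteq> 0) \<and>
     \<Omega> \<inter> U = {x\<in>U. \<rho> x < 0} \<and> frontier \<Omega> \<inter> U = {x\<in>U. \<rho> x = 0}"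

definition smooth_bounded_domain :: "'a::euclidean_space set \<Rightarrow> bool" where
  "smooth_bounded_domain \<Omega> \<longleftrightarrow>
     open \<Omega> \<and> connected \<Omega> \<and> \<Omega> \<noteq> {} \<and> bounded \<Omega> \<and>
     (\<forall>p\<in>frontier \<Omega>. \<exists>U \<rho>. local_defining_function \<Omega> p U \<rho>)"

text \<open>The defining function is negative inside, so its normalised gradient points outwards.
  The description is unambiguous by \<open>outward_normal_unique\<close> below.\<close>

definition outward_normal :: "'a::euclidean_space set \<Rightarrow> 'a \<Rightarrow> 'a" where
  "outward_normal \<Omega> p =
     (THE v. \<exists>U \<rho>. local_defining_function \<Omega> p U \<rho> \<and> v = sgn (grad \<rho> p))"

lemma grad_inner_DERIV:
  assumes "f differentiable (at p)"
  shows "((\<lambda>t. f (p + t *\<^sub>R v)) has_real_derivative grad f p \<bullet> v) (at 0)"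
proof -
  let ?D = "frechet_derivative f (at p)"
  have fd: "(f has_derivative ?D) (at p)"
    using assms frechet_derivative_works by blast
  then have lin: "linear ?D"
    using has_derivative_linear by blast
  have "?D v = ?D (\<Sum>b\<in>Basis. (v \<bullet> b) *\<^sub>R b)"
    by (simp add: euclidean_representation)
  also have "\<dots> = grad f p \<bullet> v"
    by (simp add: linear_sum[OF lin] linear_cmul[OF lin] grad_def inner_sum_left
        inner_commute[of v] mult.commute)
  finally have Dv: "?D v = grad f p \<bullet> v" .
  have "((\<lambda>t. p + t *\<^sub>R v) has_derivative (\<lambda>t. t *\<^sub>R v)) (at 0)"
    by (auto intro!: derivative_eq_intros)
  then have "((\<lambda>t. f (p + t *\<^sub>R v)) has_derivative (\<lambda>t. ?D (t *\<^sub>R v))) (at 0)"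
    using has_derivative_compose[of "\<lambda>t. p + t *\<^sub>R v" _ 0 UNIV f ?D] fd by simp
  then show ?thesis
    by (simp add: has_field_derivative_def linear_cmul[OF lin] Dv mult_commute_abs)
qed

lemma outward_normal_unique:
  assumes p: "p \<in> frontier \<Omega>"
    and 1: "local_defining_function \<Omega> p U \<rho>" and 2: "local_defining_function \<Omega> p V \<sigma>"
  shows "sgn (grad \<rho> p) = sgn (grad \<sigma> p)"
proof (rule ccontr)
  assume neq: "sgn (grad \<rho> p) \<noteq> sgn (grad \<sigma> p)"
  define a where "a = sgn (grad \<rho> p)"
  define b where "b = sgn (grad \<sigma> p)"
  define v where "v = b - a"
  have pU: "p \<in> U" "p \<in> V" "grad \<rho> p \<noteq> 0" "grad \<sigma> p \<noteq> 0" "open U" "open V"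
    using 1 2 by (auto simp: local_defining_function_def)
  have zero: "\<rho> p = 0" "\<sigma> p = 0"
    using 1 2 p by (auto simp: local_defining_function_def)
  have "Ck_on (Suc 0) \<rho> U" "Ck_on (Suc 0) \<sigma> V"
    using 1 2 by (auto simp: local_defining_function_def smooth_on_def)
  then have diff: "\<rho> differentiable (at p)" "\<sigma> differentiable (at p)"
    using pU by auto
  have ab: "a \<bullet> a = 1" "b \<bullet> b = 1"
    using pU by (simp_all add: a_def b_def norm_sgn flip: power2_norm_eq_inner)
  have "0 < v \<bullet> v"
    using neq by (simp add: v_def a_def b_def)
  then have lt: "a \<bullet> b < 1"
    by (simp add: v_def inner_diff ab inner_commute)
  have gr: "grad \<rho> p \<bullet> v = norm (grad \<rho> p) * (a \<bullet> v)"
      "grad \<sigma> p \<bullet> v = norm (grad \<sigma> p) * (b \<bullet> v)"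
    using pU by (simp_all add: a_def b_def sgn_div_norm field_simps)
  have neg: "grad \<rho> p \<bullet> v < 0" and pos: "0 < grad \<sigma> p \<bullet> v"
    using pU lt unfolding gr by (simp_all add: v_def inner_diff ab inner_commute mult_less_0_iff)
  obtain d1 where d1: "d1 > 0" "\<And>h. 0 < h \<Longrightarrow> h < d1 \<Longrightarrow> \<rho> (p + h *\<^sub>R v) < 0"
    using DERIV_neg_dec_right[OF grad_inner_DERIV[OF diff(1)] neg] zero by auto
  obtain d2 where d2: "d2 > 0" "\<And>h. 0 < h \<Longrightarrow> h < d2 \<Longrightarrow> \<sigma> (p + h *\<^sub>R v) > 0"
    using DERIV_pos_inc_right[OF grad_inner_DERIV[OF diff(2)] pos] zero by auto
  have "((\<lambda>h. p + h *\<^sub>R v) \<longlongrightarrow> p + 0 *\<^sub>R v) (at_right 0)"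
    by (intro tendsto_intros)
  then have "\<forall>\<^sub>F h in at_right 0. p + h *\<^sub>R v \<in> U \<inter> V"
    by (rule topological_tendstoD) (use pU in auto)
  then obtain d3 where d3: "d3 > 0" "\<And>h. 0 < h \<Longrightarrow> h < d3 \<Longrightarrow> p + h *\<^sub>R v \<in> U \<inter> V"
    unfolding eventually_at_right_field by auto
  define h where "h = min d1 (min d2 d3) / 2"
  have h: "0 < h" "h < d1" "h < d2" "h < d3"
    using d1(1) d2(1) d3(1) by (auto simp: h_def)
  have "\<Omega> \<inter> U = {x\<in>U. \<rho> x < 0}" "\<Omega> \<inter> V = {x\<in>V. \<sigma> x < 0}"
    using 1 2 unfolding local_defining_function_def by blast+
  moreover have "p + h *\<^sub>R v \<in> U" "p + h *\<^sub>R v \<in> V"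
    using d3(2)[OF h(1,4)] by blast+
  moreover have "\<rho> (p + h *\<^sub>R v) < 0" "\<not> \<sigma> (p + h *\<^sub>R v) < 0"
    using d1(2)[OF h(1,2)] d2(2)[OF h(1,3)] by simp_all
  ultimately have "p + h *\<^sub>R v \<in> \<Omega>" "p + h *\<^sub>R v \<notin> \<Omega>"
    by blast+
  then show False by blast
qed

lemma outward_normal_eq:
  assumes "p \<in> frontier \<Omega>" "local_defining_function \<Omega> p U \<rho>"
  shows "outward_normal \<Omega> p = sgn (grad \<rho> p)"
  unfolding outward_normal_def
  using assms outward_normal_unique by (intro the_equality) blast+

section \<open>Cylinders and graphs\<close>

text \<open>Points of \<open>\<real>\<^sup>N\<close> are pairs \<open>(x', x\<^sub>N)\<close>, so that \<open>'a\<close> below plays the role of \<open>\<real>\<^sup>N\<^sup>-\<^sup>1\<close>.\<close>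

definition cylinder :: "'a::euclidean_space set \<Rightarrow> ('a \<times> real) set" where
  "cylinder \<omega> = \<omega> \<times> {0<..}"

definition cylinder_normal :: "'a::euclidean_space set \<Rightarrow> 'a \<times> real \<Rightarrow> 'a \<times> real" where
  "cylinder_normal \<omega> x = (outward_normal \<omega> (fst x), 0)"

definition graph_over :: "'a::euclidean_space set \<Rightarrow> ('a \<Rightarrow> real) \<Rightarrow> ('a \<times> real) set" where
  "graph_over \<omega> \<phi> = {(x', xN). x' \<in> \<omega> \<and> xN = \<phi> x'}"

definition graph_normal ::
    "'a::euclidean_space set \<Rightarrow> ('a \<Rightarrow> real) \<Rightarrow> 'a \<times> real \<Rightarrow> 'a \<times> real" where
  "graph_normal \<omega> \<phi> x =
     (1 / sqrt (1 + (norm (grad_closure \<omega> \<phi> (fst x)))\<^sup>2)) *\<^sub>R (- grad_closure \<omega> \<phi> (fst x), 1)"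

text \<open>The mean curvature at the point \<open>(x', \<phi> x')\<close>, as a function of \<open>x'\<close>; here
  \<open>DIM('a) = N - 1\<close>.\<close>

definition graph_mean_curvature :: "('a::euclidean_space \<Rightarrow> real) \<Rightarrow> 'a \<Rightarrow> real" where
  "graph_mean_curvature \<phi> x' =
     - (1 / real DIM('a)) *
       divergence (\<lambda>y. (1 / sqrt (1 + (norm (grad \<phi> y))\<^sup>2)) *\<^sub>R grad \<phi> y) x'"

text \<open>When \<open>\<phi>\<close> is positive and continuous on the closure of \<open>\<omega>\<close>, the contact points below all lie
  on the lateral boundary, where \<open>cylinder_normal\<close> is the outward normal of the cylinder.\<close>

definition meets_cylinder_orthogonally ::
    "'a::euclidean_space set \<Rightarrow> ('a \<Rightarrow> real) \<Rightarrow> bool" where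
  "meets_cylinder_orthogonally \<omega> \<phi> \<longleftrightarrow>
     (\<forall>x \<in> closure (graph_over \<omega> \<phi>) \<inter> frontier (cylinder \<omega>).
        graph_normal \<omega> \<phi> x \<bullet> cylinder_normal \<omega> x = 0)"

end

(* Expanding the divergence, constant mean curvature H says that the Laplacian of \<phi> equals
   -(N - 1) H sqrt (1 + |grad \<phi>|^2) up to an error of at most K |grad \<phi>|^2, where K bounds the
   second derivatives. So \<phi> (if H \<le> 0) or -\<phi> (if H > 0) is a subsolution u of the inequality
   Laplacian u \<ge> -K |grad u|^2, and the strong maximum principle and the Hopf lemma apply to u:
   if u is not constant, it attains its maximum only on the boundary and has a positive outward
   normal derivative there. Orthogonality of the contact is the Neumann condition
   grad \<phi> . \<nu> = 0, which excludes this. Hence \<phi> is constant, and then H = 0. *)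

theory Submission
  imports Defs
begin

section \<open>Calculus of functions with pure second partial derivatives\<close>

text \<open>Only the pure second partials \<open>H b\<close> enter the maximum principle, and no continuity of them is
  needed, so this is weaker than being twice differentiable with gradient \<open>g\<close>.\<close>

definition has_second_partials ::
    "('a::euclidean_space \<Rightarrow> real) \<Rightarrow> ('a \<Rightarrow> 'a) \<Rightarrow> ('a \<Rightarrow> 'a \<Rightarrow> real) \<Rightarrow> 'a set \<Rightarrow> bool" where
  "has_second_partials f g H U \<longleftrightarrow>
     (\<forall>x\<in>U. (f has_derivative (\<lambda>v. g x \<bullet> v)) (at x) \<and>
        (\<forall>b\<in>Basis. ((\<lambda>t. g (x + t *\<^sub>R b) \<bullet> b) has_real_derivative H b x) (at 0)))"

lemma has_second_partials_subset:
  "has_second_partials f g H U \<Longrightarrow> V \<subseteq> U \<Longrightarrow> has_second_partials f g H V"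
  by (auto simp: has_second_partials_def)

lemma has_second_partials_line:
  assumes "has_second_partials f g H U" "x + t *\<^sub>R v \<in> U"
  shows "((\<lambda>t. f (x + t *\<^sub>R v)) has_real_derivative g (x + t *\<^sub>R v) \<bullet> v) (at t)"
proof -
  have "((\<lambda>t. x + t *\<^sub>R v) has_derivative (\<lambda>t. t *\<^sub>R v)) (at t)"
    by (auto intro!: derivative_eq_intros)
  moreover have "(f has_derivative (\<lambda>w. g (x + t *\<^sub>R v) \<bullet> w)) (at (x + t *\<^sub>R v))"
    using assms by (auto simp: has_second_partials_def)
  ultimately have "((\<lambda>t. f (x + t *\<^sub>R v)) has_derivative (\<lambda>s. g (x + t *\<^sub>R v) \<bullet> (s *\<^sub>R v))) (at t)"
    by (rule has_derivative_compose)
  then show ?thesis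
    by (simp add: has_field_derivative_def mult_commute_abs)
qed

lemma has_second_partials_continuous_on:
  assumes "has_second_partials f g H U"
  shows "continuous_on U f"
  using assms has_derivative_continuous
  by (fastforce simp: has_second_partials_def intro!: continuous_at_imp_continuous_on)

lemma has_second_partials_add:
  assumes "has_second_partials f g H U" "has_second_partials f' g' H' U"
  shows "has_second_partials (\<lambda>x. f x + f' x) (\<lambda>x. g x + g' x) (\<lambda>b x. H b x + H' b x) U"
  using assms unfolding has_second_partials_def inner_add_left
  by (auto intro!: derivative_intros)

lemma has_second_partials_cmult:
  assumes "has_second_partials f g H U"
  shows "has_second_partials (\<lambda>x. c * f x) (\<lambda>x. c *\<^sub>R g x) (\<lambda>b x. c * H b x) U"
  using assms unfolding has_second_partials_def inner_scaleR_left
  by (auto intro!: derivative_intros DERIV_cmult)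

text \<open>Used in two roles: with \<open>d\<close> a squared radius it is a defining function of a
  ball, and with \<open>d = 0\<close> it is a perturbation that vanishes only at
  \<open>c\<close>.\<close>

lemma has_second_partials_norm_sq:
  "has_second_partials (\<lambda>x. (norm (x - c))\<^sup>2 - d) (\<lambda>x. 2 *\<^sub>R (x - c)) (\<lambda>b x. 2) U"
proof -
  have 1: "((\<lambda>x. (x - c) \<bullet> (x - c) - d) has_derivative (\<lambda>v. (2 *\<^sub>R (x - c)) \<bullet> v)) (at x)" for x
    by (auto intro!: derivative_eq_intros simp: fun_eq_iff inner_commute algebra_simps)
  have 2: "((\<lambda>t. (2 *\<^sub>R (x + t *\<^sub>R b - c)) \<bullet> b) has_real_derivative 2) (at 0)"
    if "b \<in> Basis" for x b :: 'a
  proof -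
    have "(2 *\<^sub>R (x + t *\<^sub>R b - c)) \<bullet> b = 2 * ((x - c) \<bullet> b) + 2 * t" for t
      using that by (simp add: algebra_simps)
    then show ?thesis by (auto intro!: derivative_eq_intros)
  qed
  show ?thesis
    using 1 2 by (simp add: has_second_partials_def power2_norm_eq_inner)
qed

text \<open>The barrier is the second-order Taylor polynomial of
  \<open>(exp (-2 * A * \<sigma>) - 1) / (2 * A)\<close>, a polynomial substitute for the usual
  exponential one. Summed over \<open>b\<close>, the last term becomes \<open>2 * A\<close> times
  the squared norm of \<open>S x\<close>, which dominates when \<open>A\<close> is large.\<close>

lemma has_second_partials_barrier:
  assumes "has_second_partials \<sigma> S H U"
  shows "has_second_partials (\<lambda>x. A * (\<sigma> x)\<^sup>2 - \<sigma> x) (\<lambda>x. (2 * A * \<sigma> x - 1) *\<^sub>R S x)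
           (\<lambda>b x. (2 * A * \<sigma> x - 1) * H b x + 2 * A * (S x \<bullet> b)\<^sup>2) U"
  unfolding has_second_partials_def
proof (intro ballI conjI)
  fix x assume x: "x \<in> U"
  then have "(\<sigma> has_derivative (\<lambda>v. S x \<bullet> v)) (at x)"
    using assms by (simp add: has_second_partials_def)
  then show "((\<lambda>x. A * (\<sigma> x)\<^sup>2 - \<sigma> x) has_derivative (\<lambda>v. ((2 * A * \<sigma> x - 1) *\<^sub>R S x) \<bullet> v)) (at x)"
    by (auto intro!: derivative_eq_intros simp: algebra_simps)
next
  fix x b :: 'a assume x: "x \<in> U" and b: "b \<in> Basis"
  have 1: "((\<lambda>t. S (x + t *\<^sub>R b) \<bullet> b) has_real_derivative H b x) (at 0)"
    using assms x b by (simp add: has_second_partials_def)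
  have 2: "((\<lambda>t. \<sigma> (x + t *\<^sub>R b)) has_real_derivative S x \<bullet> b) (at 0)"
    using has_second_partials_line[OF assms, of x 0 b] x by simp
  show "((\<lambda>t. ((2 * A * \<sigma> (x + t *\<^sub>R b) - 1) *\<^sub>R S (x + t *\<^sub>R b)) \<bullet> b) has_real_derivative
         (2 * A * \<sigma> x - 1) * H b x + 2 * A * (S x \<bullet> b)\<^sup>2) (at 0)"
    unfolding inner_scaleR_left
    by (rule derivative_eq_intros 1 2 refl | simp add: power2_eq_square algebra_simps)+
qed

text \<open>Restriction to coordinate lines reduces both claims to one variable. If
  \<open>H b x\<close> were positive, the first derivative along \<open>b\<close>, which is zero at
  \<open>x\<close>, would be positive just to the right of it, and \<open>f\<close> would increase
  strictly there. This uses the second derivative at \<open>x\<close> alone.\<close>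

lemma second_partials_local_max:
  assumes f: "has_second_partials f g H U" and V: "open V" "V \<subseteq> U" "x \<in> V"
    and max: "\<And>y. y \<in> V \<Longrightarrow> f y \<le> f x"
  shows "g x = 0" and "b \<in> Basis \<Longrightarrow> H b x \<le> 0"
proof -
  obtain e where e: "e > 0" "ball x e \<subseteq> V"
    using V by (meson open_contains_ball)
  have grad0: "g x \<bullet> b = 0" if b: "b \<in> Basis" for b
  proof (rule DERIV_local_max[OF _ e(1)])
    show "((\<lambda>t. f (x + t *\<^sub>R b)) has_real_derivative g x \<bullet> b) (at 0)"
      using has_second_partials_line[OF f, of x 0 b] V by auto
    show "\<forall>t. \<bar>0 - t\<bar> < e \<longrightarrow> f (x + t *\<^sub>R b) \<le> f (x + 0 *\<^sub>R b)"
      using e b by (auto intro!: max simp: dist_norm subset_iff)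
  qed
  then show "g x = 0"
    by (simp add: euclidean_eq_iff[of "g x"])
  assume b: "b \<in> Basis"
  show "H b x \<le> 0"
  proof (rule ccontr)
    assume "\<not> H b x \<le> 0"
    then have "H b x > 0" by simp
    moreover have "((\<lambda>t. g (x + t *\<^sub>R b) \<bullet> b) has_real_derivative H b x) (at 0)"
      using f b V by (auto simp: has_second_partials_def)
    ultimately obtain d where d: "d > 0" "\<And>h. 0 < h \<Longrightarrow> h < d \<Longrightarrow> 0 < g (x + h *\<^sub>R b) \<bullet> b"
      using DERIV_pos_inc_right[of "\<lambda>t. g (x + t *\<^sub>R b) \<bullet> b" "H b x" 0] grad0[OF b] by auto
    define h where "h = min d e / 2"
    have h: "0 < h" "h < d" "h < e"
      using d e by (auto simp: h_def)
    have inV: "x + t *\<^sub>R b \<in> V" if "\<bar>t\<bar> \<le> h" for t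
      using that h e b by (auto simp: dist_norm subset_iff)
    have D: "((\<lambda>t. f (x + t *\<^sub>R b)) has_real_derivative g (x + t *\<^sub>R b) \<bullet> b) (at t)"
      if "\<bar>t\<bar> \<le> h" for t
      using has_second_partials_line[OF f] inV[OF that] V by blast
    have "f (x + 0 *\<^sub>R b) < f (x + h *\<^sub>R b)"
    proof (rule DERIV_pos_imp_increasing_open[OF h(1)])
      fix t assume "0 < t" "t < h"
      then show "\<exists>y. ((\<lambda>t. f (x + t *\<^sub>R b)) has_real_derivative y) (at t) \<and> y > 0"
        using D[of t] d(2)[of t] h by force
    next
      show "continuous_on {0..h} (\<lambda>t. f (x + t *\<^sub>R b))"
        by (rule DERIV_continuous_on[OF DERIV_subset[OF D]]) auto
    qed
    with max[OF inV[of h]] h show False by simp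
  qed
qed

section \<open>The Hopf lemma\<close>

text \<open>A small multiple of a barrier \<open>h\<close> that vanishes at \<open>p\<close> and
  grows linearly along \<open>- R p\<close> can be added to \<open>u\<close> without exceeding
  \<open>u p\<close> near \<open>p\<close>, so \<open>u\<close> itself must drop linearly. The
  sublevel set of \<open>\<rho>\<close> takes the place of the interior ball of the classical proof.
  The point \<open>p\<close> may lie on the boundary of \<open>\<Omega>\<close> or inside it; the
  conclusion is an inequality between values because on the boundary \<open>u\<close> need not be
  differentiable.\<close>

lemma hopf_lemma:
  fixes u \<rho> :: "'a::euclidean_space \<Rightarrow> real"
  assumes u: "has_second_partials u g H \<Omega>" and cont: "continuous_on (insert p \<Omega>) u"
    and lap: "\<And>x. x \<in> \<Omega> \<Longrightarrow> - K * (norm (g x))\<^sup>2 \<le> (\<Sum>b\<in>Basis. H b x)"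
    and \<rho>: "has_second_partials \<rho> R P U" and U: "open U" "p \<in> U"
    and R: "continuous_on U R" "R p \<noteq> 0" and P: "\<And>x. x \<in> U \<Longrightarrow> \<bar>\<Sum>b\<in>Basis. P b x\<bar> \<le> B"
    and p: "\<rho> p = 0"
    and below: "\<And>x. x \<in> U \<Longrightarrow> \<rho> x < 0 \<Longrightarrow> x \<in> \<Omega> \<and> u x < u p"
  shows "\<exists>c>0. \<forall>\<^sub>F t in at_right 0. u (p - t *\<^sub>R R p) \<le> u p - c * t"
proof -
  text \<open>The perturbation makes \<open>{x. \<sigma> x \<le> 0}\<close> touch the boundary of \<open>\<Omega>\<close> at \<open>p\<close> only.\<close>
  define \<sigma> where "\<sigma> x = \<rho> x + ((norm (x - p))\<^sup>2 - 0)" for x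
  define S where "S x = R x + 2 *\<^sub>R (x - p)" for x
  define Q where "Q b x = P b x + 2" for b x
  have \<sigma>: "has_second_partials \<sigma> S Q U"
    unfolding \<sigma>_def S_def Q_def by (intro has_second_partials_add \<rho> has_second_partials_norm_sq)
  define B' where "B' = \<bar>B\<bar> + 2 * real DIM('a)"
  have Q: "\<bar>\<Sum>b\<in>Basis. Q b x\<bar> \<le> B'" if "x \<in> U" for x
    using P[OF that] by (simp add: Q_def B'_def sum.distrib)
  have B'_nn: "B' \<ge> 0" by (simp add: B'_def)
  have Sp: "S p = R p" by (simp add: S_def)
  have \<sigma>p: "\<sigma> p = 0" by (simp add: \<sigma>_def p)
  have below': "x \<in> \<Omega> \<and> u x < u p" if "x \<in> U" "x \<noteq> p" "\<sigma> x \<le> 0" for x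
  proof -
    have "(norm (x - p))\<^sup>2 > 0" using that by simp
    then have "\<rho> x < 0" using that(3) unfolding \<sigma>_def by linarith
    then show ?thesis using below that by blast
  qed
  have S_cont: "continuous_on U S" unfolding S_def by (intro continuous_intros R)
  have \<sigma>_cont: "continuous_on U \<sigma>" using \<sigma> by (rule has_second_partials_continuous_on)
  \<comment> \<open>Since \<open>S p = R p\<close> has norm \<open>2 * m\<close>, the norm of
    \<open>S\<close> stays between \<open>m\<close> and \<open>3 * m\<close> near
    \<open>p\<close>.\<close>
  define m where "m = norm (R p) / 2"
  have m: "m > 0" using R by (simp add: m_def)
  \<comment> \<open>In the Laplacian of the barrier the term with \<open>Q\<close> is at most
    \<open>2 * B'\<close> in absolute value as long as
    \<open>\<bar>2 * A * \<sigma> x\<bar> \<le> 1\<close>. This \<open>A\<close> makes the gradient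
    term at least \<open>2 * B' + 1\<close>, which leaves 1.\<close>
  define A where "A = (2 * B' + 1) / (2 * m\<^sup>2)"
  have A: "A > 0" "2 * A * m\<^sup>2 = 2 * B' + 1"
    using m B'_nn by (auto simp: A_def field_simps intro!: divide_pos_pos)
  have "(S \<longlongrightarrow> S p) (nhds p)" "(\<sigma> \<longlongrightarrow> \<sigma> p) (nhds p)"
    using S_cont \<sigma>_cont U
    by (auto simp: continuous_on_eq_continuous_at isCont_def tendsto_at_iff_tendsto_nhds)
  then have lim: "((\<lambda>x. norm (S x)) \<longlongrightarrow> 2 * m) (nhds p)" "((\<lambda>x. \<bar>\<sigma> x\<bar>) \<longlongrightarrow> 0) (nhds p)"
    using tendsto_norm[of S "S p"] tendsto_rabs_zero[of \<sigma>] by (auto simp: Sp \<sigma>p m_def)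
  have "\<forall>\<^sub>F x in nhds p. x \<in> U \<and> m < norm (S x) \<and> norm (S x) < 3 * m \<and> \<bar>\<sigma> x\<bar> < 1 / (2 * A)"
    using m A U order_tendstoD[OF lim(1)] order_tendstoD[OF lim(2)]
    by (intro eventually_conj eventually_nhds_in_open) auto
  then obtain r' where r': "r' > 0" and near':
    "\<And>x. dist x p < r' \<Longrightarrow> x \<in> U \<and> m < norm (S x) \<and> norm (S x) < 3 * m \<and> \<bar>\<sigma> x\<bar> < 1 / (2 * A)"
    unfolding eventually_nhds_metric by blast
  define r where "r = r' / 2"
  have r: "r > 0" using r' by (simp add: r_def)
  have near: "x \<in> U" "m < norm (S x)" "norm (S x) < 3 * m" "\<bar>2 * A * \<sigma> x\<bar> \<le> 1"
    if "x \<in> cball p r" for x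
  proof -
    have "dist x p < r'" using that r' by (auto simp: r_def dist_commute)
    from near'[OF this] A show "x \<in> U" "m < norm (S x)" "norm (S x) < 3 * m" "\<bar>2 * A * \<sigma> x\<bar> \<le> 1"
      by (auto simp: abs_mult field_simps)
  qed
  text \<open>The barrier is positive where \<open>\<sigma> < 0\<close>, and the quadratic term makes its Laplacian at least 1
    near \<open>p\<close>, as \<open>S\<close> does not vanish there.\<close>
  define h where "h x = A * (\<sigma> x)\<^sup>2 - \<sigma> x" for x
  define h1 where "h1 x = (2 * A * \<sigma> x - 1) *\<^sub>R S x" for x
  define h2 where "h2 b x = (2 * A * \<sigma> x - 1) * Q b x + 2 * A * (S x \<bullet> b)\<^sup>2" for b x
  have h: "has_second_partials h h1 h2 U"
    unfolding h_def h1_def h2_def by (rule has_second_partials_barrier[OF \<sigma>])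
  have h1_le: "norm (h1 x) \<le> 6 * m" if "x \<in> cball p r" for x
  proof -
    have "\<bar>2 * A * \<sigma> x - 1\<bar> * norm (S x) \<le> 2 * (3 * m)"
      using near[OF that] by (intro mult_mono) auto
    then show ?thesis by (simp add: h1_def)
  qed
  have h2_ge: "1 \<le> (\<Sum>b\<in>Basis. h2 b x)" if "x \<in> cball p r" for x
  proof -
    have "\<bar>(2 * A * \<sigma> x - 1) * (\<Sum>b\<in>Basis. Q b x)\<bar> \<le> 2 * B'"
      unfolding abs_mult using near[OF that] Q[of x] by (intro mult_mono) auto
    moreover have "m\<^sup>2 \<le> (norm (S x))\<^sup>2"
      using near[OF that] m by (intro power_mono) auto
    then have "2 * A * m\<^sup>2 \<le> 2 * A * (norm (S x))\<^sup>2"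
      using A(1) by (intro mult_left_mono) auto
    moreover have S2: "(norm (S x))\<^sup>2 = (\<Sum>b\<in>Basis. (S x \<bullet> b)\<^sup>2)"
      unfolding power2_norm_eq_inner euclidean_inner[of "S x" "S x"] by (simp add: power2_eq_square)
    have "(\<Sum>b\<in>Basis. h2 b x) =
        (2 * A * \<sigma> x - 1) * (\<Sum>b\<in>Basis. Q b x) + 2 * A * (norm (S x))\<^sup>2"
      unfolding S2 h2_def by (simp add: sum.distrib sum_distrib_left)
    ultimately show ?thesis
      using A(2) by linarith
  qed
  have h_le: "h x \<le> 1 / A" if "x \<in> cball p r" for x
  proof -
    have "\<bar>A * \<sigma> x\<bar> \<le> 1 / 2" using near[OF that] by simp
    then have "A * h x \<le> 1"
      using mult_mono[of "\<bar>A * \<sigma> x\<bar>" "1/2" "\<bar>A * \<sigma> x\<bar>" "1/2"]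
      by (simp add: h_def power2_eq_square algebra_simps abs_mult_self_eq)
    then show ?thesis using A by (simp add: field_simps)
  qed
  \<comment> \<open>The comparison region. It meets the complement of \<open>\<Omega>\<close> in
    \<open>p\<close> at most, and a point of it that is neither on the sphere nor on the zero set of
    \<open>\<sigma>\<close> has a neighbourhood inside it.\<close>
  define G where "G = {x \<in> cball p r. \<sigma> x \<le> 0}"
  have \<sigma>_cont': "continuous_on (cball p r) \<sigma>"
    using near(1) by (intro continuous_on_subset[OF \<sigma>_cont]) blast
  have compact_G: "compact G"
  proof -
    have "G = cball p r \<inter> {x \<in> cball p r. \<sigma> x \<le> 0}" by (auto simp: G_def)
    moreover have "closed {x \<in> cball p r. \<sigma> x \<le> 0}"
      by (intro closed_Collect_le continuous_on_closed_Collect_le \<sigma>_cont' continuous_intros) auto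
    ultimately show ?thesis by (metis compact_Int_closed compact_cball)
  qed
  have pG: "p \<in> G" using r by (simp add: G_def \<sigma>p)
  have G_sub: "G \<subseteq> insert p \<Omega>" using below' near(1) by (auto simp: G_def)
  have u_cont: "continuous_on G u" using continuous_on_subset[OF cont G_sub] .
  have h_cont: "continuous_on G h"
    unfolding h_def by (intro continuous_intros continuous_on_subset[OF \<sigma>_cont']) (auto simp: G_def)
  \<comment> \<open>On the spherical part of \<open>G\<close> compactness turns
    \<open>u x < u p\<close> into a uniform gap. If that part is empty, any positive number will
    do.\<close>
  obtain \<delta> where \<delta>: "\<delta> > 0" "\<And>x. x \<in> G \<Longrightarrow> dist p x = r \<Longrightarrow> u x \<le> u p - \<delta>"
  proof (cases "G \<inter> sphere p r = {}")
    case True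
    then show ?thesis using that[of 1] by (metis Int_iff empty_iff mem_sphere zero_less_one)
  next
    case False
    moreover have "compact (G \<inter> sphere p r)"
      using compact_G by (intro compact_Int_closed) auto
    moreover have "continuous_on (G \<inter> sphere p r) u"
      using u_cont continuous_on_subset by blast
    ultimately obtain y where y: "y \<in> G \<inter> sphere p r" "\<And>x. x \<in> G \<inter> sphere p r \<Longrightarrow> u x \<le> u y"
      using continuous_attains_sup by metis
    then have "u y < u p"
      using r by (intro conjunct2[OF below'] near(1)) (auto simp: G_def)
    then show ?thesis
      using y by (intro that[of "u p - u y"]) auto
  qed
  define M where "M = \<bar>K\<bar> * (6 * m)\<^sup>2"
  \<comment> \<open>The first bound keeps \<open>\<epsilon> * h\<close>, at most
    \<open>\<epsilon> / A\<close>, below the gap \<open>\<delta>\<close> on the sphere. The second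
    makes the gradient term, of order \<open>\<epsilon>\<^sup>2 * M\<close>, smaller than the gain
    \<open>\<epsilon>\<close> from the Laplacian of the barrier.\<close>
  define \<epsilon> where "\<epsilon> = min (\<delta> * A) (1 / (M + 1)) / 2"
  have M: "M \<ge> 0" by (simp add: M_def)
  have \<epsilon>: "\<epsilon> > 0" "\<epsilon> < \<delta> * A" "\<epsilon> * M < 1"
  proof -
    show "\<epsilon> > 0" "\<epsilon> < \<delta> * A" using \<delta>(1) A M by (auto simp: \<epsilon>_def min_def field_simps)
    have "\<epsilon> * M \<le> 1 / (M + 1) / 2 * M"
      unfolding \<epsilon>_def using M by (intro mult_right_mono divide_right_mono min.cobounded2) auto
    also have "\<dots> < 1" using M by (simp add: field_simps)
    finally show "\<epsilon> * M < 1" .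
  qed
  \<comment> \<open>A maximum point \<open>y\<close> of the sum with value above \<open>u p\<close>
    is not on the sphere because of \<open>\<delta>\<close>, and not on the zero set of
    \<open>\<sigma>\<close>, where \<open>h\<close> vanishes and \<open>u \<le> u p\<close>. So it
    lies in the open set \<open>V\<close>, where the conditions for an interior maximum
    apply.\<close>
  have key: "u x + \<epsilon> * h x \<le> u p" if "x \<in> G" for x
  proof -
    have "continuous_on G (\<lambda>x. u x + \<epsilon> * h x)" "G \<noteq> {}"
      using pG by (auto intro!: continuous_intros u_cont h_cont)
    from continuous_attains_sup[OF compact_G this(2,1)]
    obtain y where y: "y \<in> G" "\<And>x. x \<in> G \<Longrightarrow> u x + \<epsilon> * h x \<le> u y + \<epsilon> * h y"
      by blast
    have "u y + \<epsilon> * h y \<le> u p"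
    proof (rule ccontr)
      assume neg: "\<not> u y + \<epsilon> * h y \<le> u p"
      have "\<epsilon> * h y \<le> \<epsilon> * (1 / A)"
        using h_le[of y] y(1) \<epsilon>(1) by (intro mult_left_mono) (auto simp: G_def)
      also have "\<dots> < \<delta>" using \<epsilon>(2) A(1) by (simp add: divide_less_eq)
      finally have "dist p y \<noteq> r" using \<delta>(2)[OF y(1)] neg by linarith
      have "y \<noteq> p"
      proof
        assume "y = p"
        with neg show False by (simp add: h_def \<sigma>p)
      qed
      have "\<sigma> y \<noteq> 0"
      proof
        assume "\<sigma> y = 0"
        then have "u y \<le> u p" using below'[of y] near(1)[of y] y(1) \<open>y \<noteq> p\<close> by (auto simp: G_def)
        then show False using neg \<open>\<sigma> y = 0\<close> by (simp add: h_def)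
      qed
      define V where "V = {x \<in> ball p r. \<sigma> x < 0}"
      have "open V"
      proof -
        have "continuous_on (ball p r) \<sigma>" by (rule continuous_on_subset[OF \<sigma>_cont']) auto
        then have "open (ball p r \<inter> \<sigma> -` {..<0})"
          by (intro continuous_open_preimage) auto
        also have "ball p r \<inter> \<sigma> -` {..<0} = V" by (auto simp: V_def)
        finally show ?thesis .
      qed
      have yV: "y \<in> V" using y(1) \<open>dist p y \<noteq> r\<close> \<open>\<sigma> y \<noteq> 0\<close> by (auto simp: V_def G_def)
      have VG: "V \<subseteq> G" by (auto simp: V_def G_def)
      have V\<Omega>: "V \<subseteq> \<Omega>" and VU: "V \<subseteq> U"
      proof -
        show "V \<subseteq> U" using near(1) by (auto simp: V_def)
        moreover have "x \<noteq> p" "\<sigma> x \<le> 0" if "x \<in> V" for x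
          using that \<sigma>p by (auto simp: V_def)
        ultimately show "V \<subseteq> \<Omega>" using below' by blast
      qed
      have w: "has_second_partials (\<lambda>x. u x + \<epsilon> * h x) (\<lambda>x. g x + \<epsilon> *\<^sub>R h1 x)
                 (\<lambda>b x. H b x + \<epsilon> * h2 b x) V"
        using has_second_partials_subset[OF u V\<Omega>] has_second_partials_subset[OF h VU]
        by (intro has_second_partials_add has_second_partials_cmult)
      have max: "u x + \<epsilon> * h x \<le> u y + \<epsilon> * h y" if "x \<in> V" for x
        using y(2) VG that by blast
      note crit = second_partials_local_max[OF w \<open>open V\<close> order_refl yV max]
      \<comment> \<open>The gradient of the sum vanishes at \<open>y\<close>, so the gradient of
        \<open>u\<close> has size of order \<open>\<epsilon>\<close> there and its square is of
        order \<open>\<epsilon>\<^sup>2\<close>. Hence the Laplacian of \<open>u\<close> exceeds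
        \<open>- \<epsilon>\<close>, while that of \<open>\<epsilon> * h\<close> is at least
        \<open>\<epsilon>\<close>: the sum of second partials is positive, which is impossible at a
        maximum.\<close>
      have "g y = - (\<epsilon> *\<^sub>R h1 y)" using crit(1) by (simp add: eq_neg_iff_add_eq_0)
      then have "(norm (g y))\<^sup>2 = \<epsilon>\<^sup>2 * (norm (h1 y))\<^sup>2" by (simp add: power_mult_distrib)
      also have "\<dots> \<le> \<epsilon>\<^sup>2 * (6 * m)\<^sup>2"
        using h1_le[of y] y(1) by (intro mult_left_mono power_mono) (auto simp: G_def)
      finally have "\<bar>K\<bar> * (norm (g y))\<^sup>2 \<le> \<bar>K\<bar> * (\<epsilon>\<^sup>2 * (6 * m)\<^sup>2)" by (rule mult_left_mono) simp
      moreover have "K * (norm (g y))\<^sup>2 \<le> \<bar>K\<bar> * (norm (g y))\<^sup>2" by (intro mult_right_mono) auto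
      ultimately have "K * (norm (g y))\<^sup>2 \<le> \<epsilon> * (\<epsilon> * M)"
        by (simp add: M_def power2_eq_square mult_ac)
      also have "\<dots> < \<epsilon> * 1" using \<epsilon> by (intro mult_strict_left_mono) auto
      finally have "- \<epsilon> < (\<Sum>b\<in>Basis. H b y)" using lap[of y] yV V\<Omega> by auto
      moreover have "\<epsilon> * 1 \<le> \<epsilon> * (\<Sum>b\<in>Basis. h2 b y)"
        using h2_ge[of y] y(1) \<epsilon> by (intro mult_left_mono) (auto simp: G_def)
      moreover have "(\<Sum>b\<in>Basis. H b y + \<epsilon> * h2 b y) \<le> 0"
        using crit(2) by (intro sum_nonpos)
      then have "(\<Sum>b\<in>Basis. H b y) + \<epsilon> * (\<Sum>b\<in>Basis. h2 b y) \<le> 0"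
        by (simp add: sum.distrib sum_distrib_left)
      ultimately show False by linarith
    qed
    then show ?thesis using y(2)[OF that] by simp
  qed
  \<comment> \<open>Along \<open>- R p\<close> the function \<open>\<sigma>\<close> has slope
    \<open>- 2 * c\<close> at \<open>p\<close>. Half of it is kept, so that \<open>\<sigma>\<close>
    stays below \<open>- c * t\<close> for small \<open>t\<close>; then \<open>h\<close>, which is
    at least \<open>- \<sigma>\<close>, exceeds \<open>c * t\<close>.\<close>
  define c where "c = (norm (R p))\<^sup>2 / 2"
  have c: "c > 0" using R by (simp add: c_def)
  have "((\<lambda>t. \<sigma> (p + t *\<^sub>R (- R p))) has_real_derivative S p \<bullet> (- R p)) (at 0)"
    using has_second_partials_line[OF \<sigma>, of p 0 "- R p"] U by simp
  then have "((\<lambda>t. \<sigma> (p - t *\<^sub>R R p) + c * t) has_real_derivative - c) (at 0)"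
    by (auto intro!: derivative_eq_intros simp: Sp c_def power2_norm_eq_inner)
  from DERIV_neg_dec_right[OF this] obtain d where
    d: "d > 0" "\<And>t. 0 < t \<Longrightarrow> t < d \<Longrightarrow> \<sigma> (p - t *\<^sub>R R p) + c * t < 0"
    using c by (auto simp: \<sigma>p)
  have "((\<lambda>t. p - t *\<^sub>R R p) \<longlongrightarrow> p - 0 *\<^sub>R R p) (at_right 0)"
    by (intro tendsto_intros)
  then have "\<forall>\<^sub>F t in at_right 0. p - t *\<^sub>R R p \<in> ball p r"
    by (rule topological_tendstoD) (use r in auto)
  moreover have "\<forall>\<^sub>F t in at_right (0::real). 0 < t \<and> t < d"
    using d(1) by (auto simp: eventually_at_right_field intro!: exI[of _ d])
  ultimately have "\<forall>\<^sub>F t in at_right 0. u (p - t *\<^sub>R R p) \<le> u p - \<epsilon> * c * t"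
  proof eventually_elim
    case (elim t)
    have \<sigma>t: "\<sigma> (p - t *\<^sub>R R p) < - c * t" using d(2)[of t] elim by simp
    moreover have "0 < c * t" using c elim by simp
    ultimately have "p - t *\<^sub>R R p \<in> G" using elim by (auto simp: G_def)
    from key[OF this] have "u (p - t *\<^sub>R R p) + \<epsilon> * h (p - t *\<^sub>R R p) \<le> u p" .
    moreover have "0 \<le> A * (\<sigma> (p - t *\<^sub>R R p))\<^sup>2"
      using A(1) by simp
    then have "c * t \<le> h (p - t *\<^sub>R R p)"
      using \<sigma>t by (simp add: h_def)
    then have "\<epsilon> * (c * t) \<le> \<epsilon> * h (p - t *\<^sub>R R p)"
      using \<epsilon> by (intro mult_left_mono) auto
    ultimately show ?case by (simp add: mult.assoc)
  qed
  then show ?thesis using c \<epsilon> by (intro exI[of _ "\<epsilon> * c"]) simp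
qed

section \<open>The strong maximum principle\<close>

text \<open>The set \<open>Z\<close> of maximum points is closed in \<open>\<Omega>\<close>;
  connectedness finishes the proof once it is open. If it were not, some point \<open>y\<close>
  outside \<open>Z\<close> would be close to \<open>Z\<close>, and a ball about \<open>y\<close>
  would touch \<open>Z\<close> first at a point \<open>q\<close>. The Hopf lemma gives a linear drop
  of \<open>u\<close> at \<open>q\<close>, but the gradient at the interior maximum \<open>q\<close>
  is zero.\<close>

lemma strong_maximum_principle:
  fixes u :: "'a::euclidean_space \<Rightarrow> real"
  assumes \<Omega>: "open \<Omega>" "connected \<Omega>" and u: "has_second_partials u g H \<Omega>"
    and lap: "\<And>x. x \<in> \<Omega> \<Longrightarrow> - K * (norm (g x))\<^sup>2 \<le> (\<Sum>b\<in>Basis. H b x)"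
    and max: "z \<in> \<Omega>" "\<And>x. x \<in> \<Omega> \<Longrightarrow> u x \<le> u z"
    and x: "x \<in> \<Omega>"
  shows "u x = u z"
proof -
  have cont: "continuous_on \<Omega> u" using u by (rule has_second_partials_continuous_on)
  define Z where "Z = {x \<in> \<Omega>. u x = u z}"
  have closed: "closedin (top_of_set \<Omega>) Z"
    unfolding Z_def by (rule continuous_closedin_preimage_constant[OF cont])
  have "\<exists>d>0. ball p d \<subseteq> Z" if pZ: "p \<in> Z" for p
  proof -
    \<comment> \<open>The radius is doubled so that for \<open>y\<close> in \<open>ball p d\<close>
      the whole closed ball about \<open>y\<close> through \<open>p\<close> stays inside
      \<open>\<Omega>\<close>.\<close>
    obtain d where d: "d > 0" "ball p (2 * d) \<subseteq> \<Omega>"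
      using pZ \<Omega> openE[of \<Omega> p] unfolding Z_def by (metis (mono_tags) field_sum_of_halves half_gt_zero mem_Collect_eq mult_2)
    have "y \<in> Z" if y: "y \<in> ball p d" for y
    proof (rule ccontr)
      assume yZ: "y \<notin> Z"
      have sub: "cball y (dist p y) \<subseteq> \<Omega>"
      proof
        fix x assume "x \<in> cball y (dist p y)"
        then have "x \<in> ball p (2 * d)"
          using dist_triangle[of p x y] y by (auto simp: dist_commute)
        then show "x \<in> \<Omega>" using d by blast
      qed
      \<comment> \<open>\<open>C\<close> contains \<open>p\<close>, so it has a point
        \<open>q\<close> nearest to \<open>y\<close>, and the open ball about \<open>y\<close> of
        radius \<open>dist y q\<close> is free of maximum points.\<close>
      define C where "C = {x \<in> cball y (dist p y). u x = u z}"
      have "closed C"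
        unfolding C_def using continuous_on_subset[OF cont sub]
        by (intro continuous_closed_preimage_constant) auto
      then have "closed C" "C \<noteq> {}"
        using pZ by (auto simp: C_def Z_def dist_commute)
      then obtain q where q: "q \<in> C" "\<And>x. x \<in> C \<Longrightarrow> dist y q \<le> dist y x"
        using distance_attains_inf by metis
      define \<rho> where "\<rho> x = (norm (x - y))\<^sup>2 - (dist y q)\<^sup>2" for x
      have q\<Omega>: "q \<in> \<Omega>" "u q = u z" "dist y q \<le> dist p y"
        using q sub by (auto simp: C_def)
      have "y \<in> \<Omega>" using sub by auto
      then have "q \<noteq> y" using q\<Omega> yZ by (auto simp: Z_def)
      have "\<exists>c>0. \<forall>\<^sub>F t in at_right 0. u (q - t *\<^sub>R (2 *\<^sub>R (q - y))) \<le> u q - c * t"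
      proof (rule hopf_lemma[OF u _ lap])
        show "continuous_on (insert q \<Omega>) u"
          using q\<Omega> cont by (simp add: insert_absorb)
        show "has_second_partials \<rho> (\<lambda>x. 2 *\<^sub>R (x - y)) (\<lambda>b x. 2) UNIV"
          unfolding \<rho>_def by (rule has_second_partials_norm_sq)
        show "2 *\<^sub>R (q - y) \<noteq> 0" using \<open>q \<noteq> y\<close> by simp
        show "\<rho> q = 0" by (simp add: \<rho>_def dist_norm norm_minus_commute)
        fix x assume "\<rho> x < 0"
        then have "dist y x < dist y q"
          by (simp add: \<rho>_def dist_norm norm_minus_commute power_less_imp_less_base)
        moreover from this have "x \<in> cball y (dist p y)" using q\<Omega> by auto
        ultimately show "x \<in> \<Omega> \<and> u x < u q"
          using q(2)[of x] sub max(2)[of x] q\<Omega>(2) by (force simp: C_def)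
      qed (auto intro!: continuous_intros)
      then obtain c where c: "c > 0"
        "\<forall>\<^sub>F t in at_right 0. u (q - t *\<^sub>R (2 *\<^sub>R (q - y))) \<le> u q - c * t" by blast
      \<comment> \<open>With zero gradient at \<open>q\<close>, the function \<open>u\<close> plus
        \<open>c * t\<close> has positive slope \<open>c\<close> at \<open>t = 0\<close>, so it
        rises above \<open>u q\<close>, against the drop just obtained.\<close>
      have "g q = 0"
        using second_partials_local_max(1)[OF u \<Omega>(1) order_refl q\<Omega>(1)] max(2) q\<Omega>(2) by simp
      then have "((\<lambda>t. u (q + t *\<^sub>R (- (2 *\<^sub>R (q - y))))) has_real_derivative 0) (at 0)"
        using has_second_partials_line[OF u, of q 0 "- (2 *\<^sub>R (q - y))"] q\<Omega> by simp
      then have "((\<lambda>t. u (q - t *\<^sub>R (2 *\<^sub>R (q - y))) + c * t) has_real_derivative c) (at 0)"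
        by (auto intro!: derivative_eq_intros)
      from DERIV_pos_inc_right[OF this c(1)] obtain e where
        e: "e > 0" "\<And>t. 0 < t \<Longrightarrow> t < e \<Longrightarrow> u q < u (q - t *\<^sub>R (2 *\<^sub>R (q - y))) + c * t"
        by auto
      have "\<forall>\<^sub>F t in at_right 0. u q < u (q - t *\<^sub>R (2 *\<^sub>R (q - y))) + c * t"
        using e by (auto simp: eventually_at_right_field)
      with c(2) have "\<forall>\<^sub>F t in at_right (0::real). False"
        by eventually_elim simp
      then show False by simp
    qed
    then show ?thesis using d(1) by blast
  qed
  then have "open Z" by (auto simp: open_contains_ball)
  then have "openin (top_of_set \<Omega>) Z"
    by (intro open_subset) (auto simp: Z_def)
  then have "Z = \<Omega>"
    using \<Omega>(2) closed max(1) unfolding connected_clopen by (force simp: Z_def)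
  then show ?thesis using x by (auto simp: Z_def)
qed

section \<open>From Frechet derivatives to gradients and second partials\<close>

lemma grad_inner_Basis: "b \<in> Basis \<Longrightarrow> grad f x \<bullet> b = frechet_derivative f (at x) b"
  by (simp add: grad_def inner_sum_left inner_Basis if_distrib sum.delta cong: if_cong)

lemma has_derivative_grad:
  assumes "f differentiable (at x)"
  shows "(f has_derivative (\<lambda>v. grad f x \<bullet> v)) (at x)"
proof -
  have fd: "(f has_derivative frechet_derivative f (at x)) (at x)"
    using assms frechet_derivative_works by blast
  then have lin: "linear (frechet_derivative f (at x))"
    using has_derivative_linear by blast
  have "frechet_derivative f (at x) = (\<lambda>v. grad f x \<bullet> v)"
    by (rule linear_eq_stdbasis[OF lin])
       (auto simp: grad_inner_Basis intro: bounded_linear.linear bounded_linear_inner_right)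
  with fd show ?thesis by simp
qed

abbreviation second_partial :: "('a::euclidean_space \<Rightarrow> real) \<Rightarrow> 'a \<Rightarrow> 'a \<Rightarrow> 'a \<Rightarrow> real" where
  "second_partial f a b x \<equiv> frechet_derivative (\<lambda>y. frechet_derivative f (at y) a) (at x) b"

lemma has_second_partials_grad:
  assumes "\<And>x. x \<in> U \<Longrightarrow> f differentiable (at x)"
    and "\<And>x b. x \<in> U \<Longrightarrow> b \<in> Basis \<Longrightarrow> (\<lambda>y. frechet_derivative f (at y) b) differentiable (at x)"
  shows "has_second_partials f (grad f) (\<lambda>b. second_partial f b b) U"
  unfolding has_second_partials_def
proof (intro ballI conjI)
  fix x b :: 'a assume x: "x \<in> U" and b: "b \<in> Basis"
  have "((\<lambda>t. frechet_derivative f (at (x + t *\<^sub>R b)) b) has_real_derivative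
          grad (\<lambda>y. frechet_derivative f (at y) b) x \<bullet> b) (at 0)"
    by (rule grad_inner_DERIV[OF assms(2)[OF x b]])
  then show "((\<lambda>t. grad f (x + t *\<^sub>R b) \<bullet> b) has_real_derivative second_partial f b b x) (at 0)"
    using b by (simp add: grad_inner_Basis)
qed (use assms has_derivative_grad in blast)

section \<open>Subsolutions with Neumann boundary condition\<close>

text \<open>A maximum over the compact closure that is attained inside forces constancy by the
  strong maximum principle. Otherwise it is attained only on the boundary, where the Hopf lemma
  gives a drop of rate at least \<open>c\<close> along the inner normal; but by the Neumann
  condition the slope in that direction tends to zero. The condition is phrased with the limit of
  \<open>g\<close> from inside, since \<open>u\<close> need not be differentiable on the
  boundary.\<close>

lemma constant_of_neumann_boundary:
  fixes u :: "'a::euclidean_space \<Rightarrow> real"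
  assumes \<Omega>: "smooth_bounded_domain \<Omega>" and cont: "continuous_on (closure \<Omega>) u"
    and u: "has_second_partials u g H \<Omega>"
    and lap: "\<And>x. x \<in> \<Omega> \<Longrightarrow> - K * (norm (g x))\<^sup>2 \<le> (\<Sum>b\<in>Basis. H b x)"
    and neumann: "\<And>p. p \<in> frontier \<Omega> \<Longrightarrow>
      \<exists>l. (g \<longlongrightarrow> l) (at p within \<Omega>) \<and> l \<bullet> outward_normal \<Omega> p = 0"
  shows "u constant_on closure \<Omega>"
proof -
  have dom: "open \<Omega>" "connected \<Omega>" "\<Omega> \<noteq> {}" "bounded \<Omega>"
    using \<Omega> by (auto simp: smooth_bounded_domain_def)
  have "compact (closure \<Omega>)" using dom by simp
  then obtain p where p: "p \<in> closure \<Omega>" "\<And>x. x \<in> closure \<Omega> \<Longrightarrow> u x \<le> u p"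
    using continuous_attains_sup[of "closure \<Omega>" u] cont dom by auto
  show ?thesis
  proof (cases "\<exists>z\<in>\<Omega>. u z = u p")
    case True
    then obtain z where z: "z \<in> \<Omega>" "u z = u p" by blast
    have "u x = u p" if "x \<in> \<Omega>" for x
      using strong_maximum_principle[OF dom(1,2) u lap z(1) _ that] p(2) z(2) closure_subset
      by force
    then have "u x = u p" if "x \<in> closure \<Omega>" for x
      using continuous_constant_on_closure[OF cont _ that] by blast
    then show ?thesis unfolding constant_on_def by blast
  next
    case False
    have less: "u x < u p" if "x \<in> \<Omega>" for x
      using False p(2)[of x] that closure_subset[of \<Omega>] by force
    have fr: "p \<in> frontier \<Omega>"
      using less[of p] p(1) dom(1) by (auto simp: frontier_def interior_open)
    then obtain U \<rho> where \<rho>: "local_defining_function \<Omega> p U \<rho>"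
      using \<Omega> unfolding smooth_bounded_domain_def by blast
    then have U: "open U" "p \<in> U" and "smooth_on \<rho> U" and R: "grad \<rho> p \<noteq> 0"
      and inside: "\<Omega> \<inter> U = {x\<in>U. \<rho> x < 0}" and zero: "\<rho> p = 0"
      using fr by (auto simp: local_defining_function_def)
    then have "Ck_on (Suc (Suc 0)) \<rho> U" by (simp add: smooth_on_def del: Ck_on.simps)
    then have \<rho>_diff: "\<And>x. x \<in> U \<Longrightarrow> \<rho> differentiable (at x)"
      "\<And>x b. x \<in> U \<Longrightarrow> b \<in> Basis \<Longrightarrow> (\<lambda>y. frechet_derivative \<rho> (at y) b) differentiable (at x)"
      and \<rho>_cont: "\<And>b. b \<in> Basis \<Longrightarrow> continuous_on U (\<lambda>x. frechet_derivative \<rho> (at x) b)"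
      "\<And>b. b \<in> Basis \<Longrightarrow> continuous_on U (second_partial \<rho> b b)"
      by auto
    \<comment> \<open>Passing to a closed ball inside \<open>U\<close> bounds the Laplacian of
      \<open>\<rho>\<close> by compactness, as the Hopf lemma requires.\<close>
    obtain r where r: "r > 0" "cball p r \<subseteq> U"
      using U open_contains_cball by blast
    have "compact ((\<lambda>x. \<Sum>b\<in>Basis. second_partial \<rho> b b x) ` cball p r)"
      using r(2) \<rho>_cont(2)
      by (intro compact_continuous_image continuous_intros) (auto intro: continuous_on_subset)
    then obtain B where B: "\<And>x. x \<in> cball p r \<Longrightarrow> \<bar>\<Sum>b\<in>Basis. second_partial \<rho> b b x\<bar> \<le> B"
      unfolding real_norm_def[symmetric]
      by (meson compact_imp_bounded bounded_iff imageI)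
    have ball: "ball p r \<subseteq> U" using r by auto
    have "\<exists>c>0. \<forall>\<^sub>F t in at_right 0. u (p - t *\<^sub>R grad \<rho> p) \<le> u p - c * t"
    proof (rule hopf_lemma[OF u _ lap])
      show "continuous_on (insert p \<Omega>) u"
        using cont by (rule continuous_on_subset) (use p closure_subset in auto)
      show "has_second_partials \<rho> (grad \<rho>) (\<lambda>b. second_partial \<rho> b b) (ball p r)"
        using ball \<rho>_diff by (intro has_second_partials_grad) auto
      show "continuous_on (ball p r) (grad \<rho>)"
        unfolding grad_def using ball \<rho>_cont(1)
        by (intro continuous_intros) (auto intro: continuous_on_subset)
      show "x \<in> \<Omega> \<and> u x < u p" if "x \<in> ball p r" "\<rho> x < 0" for x
        using that ball inside less by blast
      show "\<bar>\<Sum>b\<in>Basis. second_partial \<rho> b b x\<bar> \<le> B" if "x \<in> ball p r" for x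
        by (rule B[OF subsetD[OF ball_subset_cball that(1)]])
    qed (use r R zero in auto)
    then obtain c where c: "c > 0"
      "\<forall>\<^sub>F t in at_right 0. u (p - t *\<^sub>R grad \<rho> p) \<le> u p - c * t" by blast
    obtain l where l: "(g \<longlongrightarrow> l) (at p within \<Omega>)" "l \<bullet> outward_normal \<Omega> p = 0"
      using neumann[OF fr] by blast
    have "l \<bullet> sgn (grad \<rho> p) = 0"
      using l(2) outward_normal_eq[OF fr \<rho>] by simp
    then have l0: "l \<bullet> grad \<rho> p = 0"
      using R by (simp add: sgn_div_norm)
    have line: "((\<lambda>t. p - t *\<^sub>R grad \<rho> p) \<longlongrightarrow> p - 0 *\<^sub>R grad \<rho> p) (at_right 0)"
      by (intro tendsto_intros)
    have ev_U: "\<forall>\<^sub>F t in at_right 0. p - t *\<^sub>R grad \<rho> p \<in> U"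
      by (rule topological_tendstoD[OF line]) (use U in auto)
    have "((\<lambda>t. \<rho> (p + t *\<^sub>R (- grad \<rho> p))) has_real_derivative grad \<rho> p \<bullet> (- grad \<rho> p)) (at 0)"
      using grad_inner_DERIV \<rho>_diff(1) U by blast
    from DERIV_neg_dec_right[OF this] obtain d where
      d: "d > 0" "\<And>t. 0 < t \<Longrightarrow> t < d \<Longrightarrow> \<rho> (p - t *\<^sub>R grad \<rho> p) < 0"
      using R zero by auto
    have "\<forall>\<^sub>F t in at_right 0. \<rho> (p - t *\<^sub>R grad \<rho> p) < 0"
      using d by (auto simp: eventually_at_right_field)
    with ev_U have ev_\<Omega>: "\<forall>\<^sub>F t in at_right 0. p - t *\<^sub>R grad \<rho> p \<in> \<Omega>"
      by eventually_elim (use inside in blast)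
    \<comment> \<open>The segment enters \<open>\<Omega>\<close> because \<open>\<rho>\<close>
      decreases along \<open>- grad \<rho> p\<close>, so the one-sided limit \<open>l\<close> of the
      gradient may be computed along it.\<close>
    have "filterlim (\<lambda>t. p - t *\<^sub>R grad \<rho> p) (at p within \<Omega>) (at_right 0)"
    proof -
      have "p \<notin> \<Omega>" using fr dom(1) by (simp add: frontier_def interior_open)
      with ev_\<Omega> have "\<forall>\<^sub>F t in at_right 0.
          p - t *\<^sub>R grad \<rho> p \<in> \<Omega> \<and> p - t *\<^sub>R grad \<rho> p \<noteq> p"
        by (elim eventually_mono) force
      then show ?thesis using line by (simp add: filterlim_at)
    qed
    from filterlim_compose[OF l(1) this]
    have "((\<lambda>t. g (p - t *\<^sub>R grad \<rho> p) \<bullet> grad \<rho> p) \<longlongrightarrow> l \<bullet> grad \<rho> p) (at_right 0)"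
      by (intro tendsto_intros)
    then have "\<forall>\<^sub>F t in at_right 0. g (p - t *\<^sub>R grad \<rho> p) \<bullet> grad \<rho> p < c"
      using l0 c(1) order_tendstoD(2) by fastforce
    from eventually_conj[OF this eventually_conj[OF ev_\<Omega> c(2)]] obtain e where
      e: "e > 0" and small: "\<And>t. 0 < t \<Longrightarrow> t < e \<Longrightarrow> g (p - t *\<^sub>R grad \<rho> p) \<bullet> grad \<rho> p < c"
      "\<And>t. 0 < t \<Longrightarrow> t < e \<Longrightarrow> p - t *\<^sub>R grad \<rho> p \<in> \<Omega>"
      "\<And>t. 0 < t \<Longrightarrow> t < e \<Longrightarrow> u (p - t *\<^sub>R grad \<rho> p) \<le> u p - c * t"
      unfolding eventually_at_right_field by auto
    define t where "t = e / 2"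
    have t: "0 < t" "t < e" using e by (auto simp: t_def)
    have in_cl: "p - s *\<^sub>R grad \<rho> p \<in> closure \<Omega>" if "s \<in> {0..t}" for s
      using small(2)[of s] that t p closure_subset[of \<Omega>] by (cases "s = 0") auto
    \<comment> \<open>The derivative of \<open>u\<close> plus \<open>c * t\<close> along the segment
      is \<open>c\<close> minus a quantity smaller than \<open>c\<close>, so the sum increases
      strictly from its value \<open>u p\<close> at the boundary point. The Hopf estimate at
      \<open>t\<close> says that it is at most \<open>u p\<close>.\<close>
    have "u (p - 0 *\<^sub>R grad \<rho> p) + c * 0 < u (p - t *\<^sub>R grad \<rho> p) + c * t"
    proof (rule DERIV_pos_imp_increasing_open[OF t(1)])
      fix s assume s: "0 < s" "s < t"
      have "((\<lambda>t. u (p + t *\<^sub>R (- grad \<rho> p))) has_real_derivative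
              g (p + s *\<^sub>R (- grad \<rho> p)) \<bullet> (- grad \<rho> p)) (at s)"
        using small(2)[of s] s t by (intro has_second_partials_line[OF u]) simp
      then have "((\<lambda>t. u (p - t *\<^sub>R grad \<rho> p) + c * t) has_real_derivative
              c - g (p - s *\<^sub>R grad \<rho> p) \<bullet> grad \<rho> p) (at s)"
        by (auto intro!: derivative_eq_intros)
      then show "\<exists>y. ((\<lambda>t. u (p - t *\<^sub>R grad \<rho> p) + c * t) has_real_derivative y) (at s) \<and> y > 0"
        using small(1)[of s] s t by force
    next
      show "continuous_on {0..t} (\<lambda>t. u (p - t *\<^sub>R grad \<rho> p) + c * t)"
        by (intro continuous_intros continuous_on_compose2[OF cont]) (use in_cl in auto)
    qed
    with small(3)[OF t] show ?thesis by simp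
  qed
qed

section \<open>The mean curvature operator in expanded form\<close>

text \<open>With \<open>W = sqrt (1 + (norm (grad f x))\<^sup>2)\<close>, the product of
  \<open>W\<close> and the divergence is the Laplacian minus the Hessian form of the gradient
  divided by \<open>W\<^sup>2\<close>. The sum inside the absolute value is exactly this last
  quotient, which is quadratic in the gradient with coefficients from the Hessian.\<close>

lemma laplacian_mean_curvature_bound:
  fixes f :: "'a::euclidean_space \<Rightarrow> real"
  assumes diff: "\<And>a. a \<in> Basis \<Longrightarrow> (\<lambda>y. frechet_derivative f (at y) a) differentiable (at x)"
  shows "\<bar>(\<Sum>b\<in>Basis. second_partial f b b x)
            + real DIM('a) * graph_mean_curvature f x * sqrt (1 + (norm (grad f x))\<^sup>2)\<bar>
         \<le> (\<Sum>b\<in>Basis. \<Sum>a\<in>Basis. \<bar>second_partial f a b x\<bar>) * (norm (grad f x))\<^sup>2"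
proof -
  define G where "G = grad f"
  define D where "D v = (\<Sum>a\<in>Basis. second_partial f a v x *\<^sub>R a)" for v
  define W where "W = sqrt (1 + G x \<bullet> G x)"
  have W: "W \<ge> 1" "W\<^sup>2 = 1 + G x \<bullet> G x" by (simp_all add: W_def)
  have G: "(G has_derivative D) (at x)"
    unfolding G_def D_def grad_def
    by (intro has_derivative_sum has_derivative_scaleR_left frechet_derivative_works[THEN iffD1] diff)
  have pos: "1 + G x \<bullet> G x > 0" using inner_ge_zero[of "G x"] by linarith
  \<comment> \<open>\<open>D\<close> is the Hessian as a linear map. The term with
    \<open>W ^ 3\<close> comes from differentiating the factor \<open>1 / W\<close>.\<close>
  have "((\<lambda>y. (1 / sqrt (1 + G y \<bullet> G y)) *\<^sub>R G y) has_derivative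
          (\<lambda>v. (1 / W) *\<^sub>R D v - ((G x \<bullet> D v) / W ^ 3) *\<^sub>R G x)) (at x)"
  proof -
    have "((\<lambda>y. 1 + G y \<bullet> G y) has_derivative (\<lambda>v. 2 * (G x \<bullet> D v))) (at x)"
      using has_derivative_add[OF has_derivative_const has_derivative_inner[OF G G], of 1]
      by (simp add: inner_commute)
    from has_derivative_real_sqrt[OF pos this]
    have sq: "((\<lambda>y. sqrt (1 + G y \<bullet> G y)) has_derivative (\<lambda>v. (G x \<bullet> D v) / W)) (at x)"
      by (simp add: W_def field_simps)
    have "sqrt (1 + G x \<bullet> G x) \<noteq> 0" using pos by simp
    from has_derivative_scaleR[OF Deriv.has_derivative_inverse[OF this sq] G]
    show ?thesis
      unfolding inverse_eq_divide W_def[symmetric]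
      by (rule has_derivative_eq_rhs) (simp add: fun_eq_iff power3_eq_cube)
  qed
  then have "divergence (\<lambda>y. (1 / sqrt (1 + (norm (G y))\<^sup>2)) *\<^sub>R G y) x =
      (\<Sum>b\<in>Basis. ((1 / W) *\<^sub>R D b - ((G x \<bullet> D b) / W ^ 3) *\<^sub>R G x) \<bullet> b)"
    unfolding divergence_def power2_norm_eq_inner by (simp flip: frechet_derivative_at)
  also have "\<dots> = (\<Sum>b\<in>Basis. D b \<bullet> b) / W - (\<Sum>b\<in>Basis. (G x \<bullet> D b) * (G x \<bullet> b)) / W ^ 3"
    by (simp add: inner_diff_left sum_subtractf sum_divide_distrib)
  also have "(\<Sum>b\<in>Basis. D b \<bullet> b) = (\<Sum>b\<in>Basis. second_partial f b b x)"
    by (intro sum.cong refl)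
       (simp add: D_def inner_sum_left inner_Basis if_distrib sum.delta cong: if_cong)
  finally have div: "divergence (\<lambda>y. (1 / sqrt (1 + (norm (G y))\<^sup>2)) *\<^sub>R G y) x * W =
      (\<Sum>b\<in>Basis. second_partial f b b x) - (\<Sum>b\<in>Basis. (G x \<bullet> D b) * (G x \<bullet> b)) / W\<^sup>2"
    using W(1) by (simp add: field_simps power2_eq_square power3_eq_cube)
  have D_le: "norm (D b) \<le> (\<Sum>a\<in>Basis. \<bar>second_partial f a b x\<bar>)" for b
    unfolding D_def by (rule norm_sum[THEN order_trans]) simp
  have "\<bar>(\<Sum>b\<in>Basis. (G x \<bullet> D b) * (G x \<bullet> b)) / W\<^sup>2\<bar>
      \<le> \<bar>\<Sum>b\<in>Basis. (G x \<bullet> D b) * (G x \<bullet> b)\<bar>"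
    using W(1) mult_left_mono[of 1 "W\<^sup>2" "\<bar>\<Sum>b\<in>Basis. (G x \<bullet> D b) * (G x \<bullet> b)\<bar>"]
    by (simp add: abs_divide divide_le_eq)
  also have "\<dots> \<le> (\<Sum>b\<in>Basis. \<bar>(G x \<bullet> D b) * (G x \<bullet> b)\<bar>)"
    by (rule sum_abs)
  also have "\<dots> \<le> (\<Sum>b\<in>Basis. (\<Sum>a\<in>Basis. \<bar>second_partial f a b x\<bar>) * (norm (G x))\<^sup>2)"
  proof (rule sum_mono)
    fix b :: 'a assume b: "b \<in> Basis"
    have "\<bar>G x \<bullet> D b\<bar> * \<bar>G x \<bullet> b\<bar>
        \<le> (norm (G x) * (\<Sum>a\<in>Basis. \<bar>second_partial f a b x\<bar>)) * norm (G x)"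
      using Cauchy_Schwarz_ineq2[of "G x" "D b"] D_le[of b] Basis_le_norm[OF b, of "G x"]
      by (intro mult_mono) (auto intro!: order_trans[OF Cauchy_Schwarz_ineq2] mult_left_mono sum_nonneg)
    then show "\<bar>(G x \<bullet> D b) * (G x \<bullet> b)\<bar>
        \<le> (\<Sum>a\<in>Basis. \<bar>second_partial f a b x\<bar>) * (norm (G x))\<^sup>2"
      by (simp add: abs_mult power2_eq_square mult_ac)
  qed
  finally show ?thesis
    using div
    by (simp add: graph_mean_curvature_def G_def W_def power2_norm_eq_inner flip: sum_distrib_right)
qed

section \<open>Boundary behaviour and orthogonal contact\<close>

lemma cont_extends_bounded:
  assumes "cont_extends f U" "bounded U"
  shows "\<exists>B. \<forall>x\<in>U. \<bar>f x\<bar> \<le> B"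
proof -
  obtain h where h: "continuous_on (closure U) h" "\<forall>x\<in>U. h x = f x"
    using assms by (auto simp: cont_extends_def)
  have "compact (h ` closure U)"
    using h assms by (intro compact_continuous_image) auto
  then obtain B where "\<forall>x\<in>closure U. \<bar>h x\<bar> \<le> B"
    by (auto simp: bounded_iff dest!: compact_imp_bounded)
  then show ?thesis using h closure_subset by (metis subsetD)
qed

lemma cont_extends_tendsto:
  assumes "cont_extends f U" "p \<in> closure U"
  shows "\<exists>l. (f \<longlongrightarrow> l) (at p within U)"
proof -
  obtain h where h: "continuous_on (closure U) h" "\<forall>x\<in>U. h x = f x"
    using assms by (auto simp: cont_extends_def)
  then have "(h \<longlongrightarrow> h p) (at p within U)"
    using assms closure_subset[of U] by (meson continuous_on_def tendsto_within_subset)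
  then have "(f \<longlongrightarrow> h p) (at p within U)"
    by (rule Lim_transform_eventually) (use h in \<open>auto simp: eventually_at_filter\<close>)
  then show ?thesis by blast
qed

text \<open>The first partials extend continuously, so the gradient has a limit \<open>L\<close> at
  \<open>p\<close>, and the graph normal at \<open>(p, \<phi> p)\<close> is a positive multiple of
  \<open>(- L, 1)\<close>. The cylinder normal has last component zero, so their inner product is a
  nonzero multiple of \<open>L \<bullet> outward_normal \<omega> p\<close>.\<close>

lemma orthogonal_contact_neumann:
  assumes \<omega>: "open \<omega>" and \<phi>: "Ck_closure (Suc k) \<phi> \<omega>"
    and pos: "\<forall>x \<in> closure \<omega>. \<phi> x > 0" and orth: "meets_cylinder_orthogonally \<omega> \<phi>"
    and p: "p \<in> frontier \<omega>"
  shows "\<exists>l. (grad \<phi> \<longlongrightarrow> l) (at p within \<omega>) \<and> l \<bullet> outward_normal \<omega> p = 0"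
proof -
  have pc: "p \<in> closure \<omega>" "p \<notin> \<omega>"
    using p \<omega> by (auto simp: frontier_def interior_open)
  have cont: "continuous_on (closure \<omega>) \<phi>" using \<phi> by (simp add: Ck_closure_def)
  \<comment> \<open>Nontriviality of the filter makes limits unique, so \<open>grad_closure\<close>,
    defined through \<open>Lim\<close>, takes the value \<open>L\<close> at
    \<open>p\<close>.\<close>
  have nt: "at p within \<omega> \<noteq> bot"
    using pc by (simp add: trivial_limit_within closure_def)
  have "cont_extends (\<lambda>x. frechet_derivative \<phi> (at x) b) \<omega>" if "b \<in> Basis" for b
    using \<phi> that by (cases k) (auto simp: Ck_closure_def)
  then have "\<forall>b\<in>Basis. \<exists>l. ((\<lambda>x. frechet_derivative \<phi> (at x) b) \<longlongrightarrow> l) (at p within \<omega>)"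
    using cont_extends_tendsto pc by blast
  then obtain l where l:
    "\<And>b. b \<in> Basis \<Longrightarrow> ((\<lambda>x. frechet_derivative \<phi> (at x) b) \<longlongrightarrow> l b) (at p within \<omega>)"
    by metis
  define L where "L = (\<Sum>b\<in>Basis. l b *\<^sub>R b)"
  have lim: "(grad \<phi> \<longlongrightarrow> L) (at p within \<omega>)"
    unfolding grad_def L_def by (intro tendsto_intros l)
  then have gc: "grad_closure \<omega> \<phi> p = L"
    unfolding grad_closure_def using nt by (rule tendsto_Lim[rotated])
  have "(\<phi> \<longlongrightarrow> \<phi> p) (at p within \<omega>)"
    using cont pc(1) closure_subset[of \<omega>] by (meson continuous_on_def tendsto_within_subset)
  then have graph_lim: "((\<lambda>x. (x, \<phi> x)) \<longlongrightarrow> (p, \<phi> p)) (at p within \<omega>)"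
    by (intro tendsto_intros)
  have "\<forall>\<^sub>F x in at p within \<omega>. (x, \<phi> x) \<in> closure (graph_over \<omega> \<phi>)"
    unfolding eventually_at_filter
    using closure_subset[of "graph_over \<omega> \<phi>"]
    by (intro always_eventually) (auto simp: graph_over_def)
  then have "(p, \<phi> p) \<in> closure (graph_over \<omega> \<phi>)"
    using Lim_in_closed_set[OF closed_closure _ nt graph_lim] by blast
  \<comment> \<open>Membership in the frontier comes from the first coordinate: \<open>p\<close>
    lies in the closure of \<open>\<omega>\<close> but not in the open set \<open>\<omega>\<close>.
    Positivity of \<open>\<phi> p\<close> keeps the second coordinate in the closed
    half-line.\<close>
  moreover have "(p, \<phi> p) \<in> frontier (cylinder \<omega>)"
    using pc \<omega> pos
    by (auto simp: frontier_def cylinder_def closure_Times interior_Times interior_open less_imp_le)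
  ultimately have "graph_normal \<omega> \<phi> (p, \<phi> p) \<bullet> cylinder_normal \<omega> (p, \<phi> p) = 0"
    using orth by (auto simp: meets_cylinder_orthogonally_def)
  moreover have "sqrt (1 + (norm L)\<^sup>2) \<noteq> 0"
    using zero_le_power2[of "norm L"] by (simp add: add_nonneg_eq_0_iff)
  ultimately have "L \<bullet> outward_normal \<omega> p = 0"
    by (simp add: graph_normal_def cylinder_normal_def gc)
  with lim show ?thesis by blast
qed

lemma frechet_derivative_eq_0:
  assumes "open U" "x \<in> U" "\<And>y. y \<in> U \<Longrightarrow> f y = c"
  shows "frechet_derivative f (at x) = (\<lambda>_. 0)"
proof -
  have "(f has_derivative (\<lambda>_. 0)) (at x)"
    by (rule has_derivative_transform_within_open[OF has_derivative_const assms(1,2)])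
       (use assms(3) in auto)
  then show ?thesis by (simp flip: frechet_derivative_at)
qed

lemma graph_mean_curvature_constant:
  assumes "open U" "x \<in> U" "\<And>y. y \<in> U \<Longrightarrow> \<phi> y = c"
  shows "graph_mean_curvature \<phi> x = 0"
proof -
  have "grad \<phi> y = 0" if "y \<in> U" for y
    using frechet_derivative_eq_0[OF assms(1) that assms(3)] by (simp add: grad_def)
  then have "frechet_derivative (\<lambda>y. (1 / sqrt (1 + (norm (grad \<phi> y))\<^sup>2)) *\<^sub>R grad \<phi> y) (at x) = (\<lambda>_. 0)"
    by (intro frechet_derivative_eq_0[OF assms(1,2), where c = 0]) simp
  then show ?thesis by (simp add: graph_mean_curvature_def divergence_def)
qed

section \<open>Constant mean curvature graphs meeting the cylinder orthogonally\<close>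

theorem proposition2p1:
  fixes N :: nat
    and \<omega> :: "(real ^ 'n) set"
    and \<phi> :: "real ^ 'n \<Rightarrow> real"
  assumes "N \<ge> 2" and "CARD('n) = N - 1"
    and "smooth_bounded_domain \<omega>"
    and "Ck_closure 2 \<phi> \<omega>"
    and "\<forall>x \<in> closure \<omega>. \<phi> x > 0"
    and "graph_mean_curvature \<phi> constant_on \<omega>"
    and "meets_cylinder_orthogonally \<omega> \<phi>"
  shows "(\<forall>x \<in> \<omega>. graph_mean_curvature \<phi> x = 0) \<and> \<phi> constant_on closure \<omega>"
proof -
  have dom: "open \<omega>" "bounded \<omega>"
    using assms(3) by (auto simp: smooth_bounded_domain_def)
  have Ck: "Ck_closure (Suc (Suc 0)) \<phi> \<omega>"
    using assms(4) by (simp add: numeral_2_eq_2)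
  then have cont: "continuous_on (closure \<omega>) \<phi>"
    and diff: "\<And>x. x \<in> \<omega> \<Longrightarrow> \<phi> differentiable (at x)"
      "\<And>x b. x \<in> \<omega> \<Longrightarrow> b \<in> Basis \<Longrightarrow> (\<lambda>y. frechet_derivative \<phi> (at y) b) differentiable (at x)"
    and ext: "\<And>a b. a \<in> Basis \<Longrightarrow> b \<in> Basis \<Longrightarrow> cont_extends (second_partial \<phi> a b) \<omega>"
    by (auto simp: Ck_closure_def)
  have "\<forall>a\<in>Basis. \<forall>b\<in>Basis. \<exists>B. \<forall>x\<in>\<omega>. \<bar>second_partial \<phi> a b x\<bar> \<le> B"
    using cont_extends_bounded ext dom(2) by blast
  then obtain B where B:
    "\<And>a b x. a \<in> Basis \<Longrightarrow> b \<in> Basis \<Longrightarrow> x \<in> \<omega> \<Longrightarrow> \<bar>second_partial \<phi> a b x\<bar> \<le> B a b"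
    by metis
  \<comment> \<open>\<open>K\<close> bounds the sum of the absolute values of all Hessian entries
    uniformly on \<open>\<omega>\<close>, because the second partials extend continuously to a
    compact set.\<close>
  define K where "K = (\<Sum>b\<in>Basis. \<Sum>a\<in>Basis. B a b)"
  obtain c where c: "\<And>x. x \<in> \<omega> \<Longrightarrow> graph_mean_curvature \<phi> x = c"
    using assms(6) by (auto simp: constant_on_def)
  \<comment> \<open>\<open>CARD('n)\<close> is the dimension of the base, so \<open>C\<close> is
    \<open>N - 1\<close> times the constant mean curvature.\<close>
  define C where "C = real CARD('n) * c"
  have lap: "\<bar>(\<Sum>b\<in>Basis. second_partial \<phi> b b x) + C * sqrt (1 + (norm (grad \<phi> x))\<^sup>2)\<bar>
      \<le> K * (norm (grad \<phi> x))\<^sup>2" if "x \<in> \<omega>" for x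
  proof -
    have "(\<Sum>b\<in>Basis. \<Sum>a\<in>Basis. \<bar>second_partial \<phi> a b x\<bar>) \<le> K"
      unfolding K_def by (intro sum_mono B that)
    then have "(\<Sum>b\<in>Basis. \<Sum>a\<in>Basis. \<bar>second_partial \<phi> a b x\<bar>) * (norm (grad \<phi> x))\<^sup>2
        \<le> K * (norm (grad \<phi> x))\<^sup>2"
      by (rule mult_right_mono) simp
    with laplacian_mean_curvature_bound[of \<phi> x] diff(2)[OF that] c[OF that] show ?thesis
      by (simp add: C_def)
  qed
  have data: "has_second_partials \<phi> (grad \<phi>) (\<lambda>b. second_partial \<phi> b b) \<omega>"
    using diff by (rule has_second_partials_grad)
  have neumann: "\<exists>l. (grad \<phi> \<longlongrightarrow> l) (at p within \<omega>) \<and> l \<bullet> outward_normal \<omega> p = 0"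
    if "p \<in> frontier \<omega>" for p
    using orthogonal_contact_neumann[OF dom(1) Ck assms(5,7) that] .
  \<comment> \<open>The estimate \<open>lap\<close> is two-sided. For \<open>C \<le> 0\<close> it
    bounds the Laplacian of \<open>\<phi>\<close> from below, and for \<open>C > 0\<close> from
    above, so that \<open>\<phi>\<close> or its negative satisfies the differential inequality; the
    Neumann condition is preserved by the change of sign.\<close>
  have const: "\<phi> constant_on closure \<omega>"
  proof (cases "C \<le> 0")
    case True
    show ?thesis
    proof (rule constant_of_neumann_boundary[OF assms(3) cont data _ neumann])
      fix x assume "x \<in> \<omega>"
      moreover have "C * sqrt (1 + (norm (grad \<phi> x))\<^sup>2) \<le> 0"
        using True by (intro mult_nonpos_nonneg) auto
      ultimately show "- K * (norm (grad \<phi> x))\<^sup>2 \<le> (\<Sum>b\<in>Basis. second_partial \<phi> b b x)"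
        using lap[of x] by simp
    qed
  next
    case False
    have "(\<lambda>x. -1 * \<phi> x) constant_on closure \<omega>"
    proof (rule constant_of_neumann_boundary[OF assms(3) _ has_second_partials_cmult[OF data]])
      show "continuous_on (closure \<omega>) (\<lambda>x. -1 * \<phi> x)"
        by (intro continuous_intros cont)
    next
      fix x assume "x \<in> \<omega>"
      moreover have "C * sqrt (1 + (norm (grad \<phi> x))\<^sup>2) \<ge> 0"
        using False by (intro mult_nonneg_nonneg) auto
      ultimately show "- K * (norm (-1 *\<^sub>R grad \<phi> x))\<^sup>2 \<le> (\<Sum>b\<in>Basis. -1 * second_partial \<phi> b b x)"
        using lap[of x] by (simp add: sum_negf)
    next
      fix p assume "p \<in> frontier \<omega>"
      then obtain l where "(grad \<phi> \<longlongrightarrow> l) (at p within \<omega>)" "l \<bullet> outward_normal \<omega> p = 0"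
        using neumann by blast
      then show "\<exists>l. ((\<lambda>x. -1 *\<^sub>R grad \<phi> x) \<longlongrightarrow> l) (at p within \<omega>) \<and> l \<bullet> outward_normal \<omega> p = 0"
        by (intro exI[of _ "- l"]) (auto intro!: tendsto_intros)
    qed
    then obtain k where k: "\<And>x. x \<in> closure \<omega> \<Longrightarrow> -1 * \<phi> x = k"
      unfolding constant_on_def by blast
    have "\<phi> x = - k" if "x \<in> closure \<omega>" for x
      using k[OF that] by linarith
    then show ?thesis unfolding constant_on_def by blast
  qed
  then obtain k where "\<And>x. x \<in> closure \<omega> \<Longrightarrow> \<phi> x = k" by (auto simp: constant_on_def)
  \<comment> \<open>Derivatives at a point of the open set \<open>\<omega>\<close> depend only on
    values in \<open>\<omega>\<close>, so constancy there makes the curvature vanish.\<close>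
  then have "\<phi> x = k" if "x \<in> \<omega>" for x
    using that closure_subset by (metis subsetD)
  then have "graph_mean_curvature \<phi> x = 0" if "x \<in> \<omega>" for x
    by (rule graph_mean_curvature_constant[OF dom(1) that])
  with const show ?thesis by blast
qed

end
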